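(* Let $\Omega_1=(-1,1)$ and, for $s\in(0,1)$, let $$w_{1,s}(x)=\left(\frac{2}{\pi}\right)^{2s}\sum_{m=0}^{\infty}\frac{(-1)^m}{(2m+1)^{2s}}\sin\left[\frac{(2m+1)\pi}{2}(x+1)\right]=\left(\frac{2}{\pi}\right)^{2s}\sum_{m=0}^{\infty}\frac{1}{(2m+1)^{2s}}\cos\left[\frac{(2m+1)\pi x}{2}\right]$$ be the solution of the spectral fractional problem $\left(-\frac{d^2}{dx^2}\right)^s w=\delta_0$ in $\Omega_1$, $w|_{x=\pm1}=0$. Then: (a) $w_{1,s}\in L_2(\Omega_1)$ if and only if $s\in(1/4,1)$. (b) $\displaystyle w_{1,s}(0)=\left(\frac{2}{\pi}\right)^{2s}\sum_{m=0}^{\infty}\frac{1}{(2m+1)^{2s}}<+\infty$ if and only if $s>\frac12$. (c) $w_{1,s}\in C\left(\overline{\Omega}_1\setminus\{0\}\right)$ for all $s\in(0,1)\setminus\{1/2\}$, and $w_{1,s}\in C\left(\overline{\Omega}_1\right)$ for all $s\in(1/2,1)$.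
   Context: Spectral fractional Laplacian with zero Dirichlet data on $\Omega_1=(-1,1)$: let $\lambda_k=\left(\frac{k\pi}{2}\right)^2$ and $e_k(x)=\sin\left[\frac{k\pi}{2}(x+1)\right]$, $k=1,2,\dots$, be the eigenvalues and $L_2(\Omega_1)$-orthonormal eigenfunctions of $-\frac{d^2}{dx^2}$ on $(-1,1)$ with homogeneous Dirichlet conditions. Then $(-\Delta_{\Omega_1,0})^s w:=\sum_{k\ge1}\lambda_k^s (w,e_k)_{L_2(\Omega_1)}e_k$. The Dirac function $\delta_0$ at the origin, $\langle\delta_0,\varphi\rangle=\varphi(0)$, is identified with its expansion $\sum_{k\ge1}\langle\delta_0,e_k\rangle e_k$; the solution $w_{1,s}$ is the series obtained by equating coefficients in $(-\Delta_{\Omega_1,0})^s w=\delta_0$, i.e. $(w,e_{2m})=0$ for $m\ge1$ and $(w,e_{2m+1})=(-1)^m\left(\frac{(2m+1)\pi}{2}\right)^{-2s}$ for $m\ge0$. Convention: $w_{1,s}\in L_2(\Omega_1)$ means that the series defining $w_{1,s}$ converges in $L_2(\Omega_1)$; $w_{1,s}\in C(A)$ means that the series converges at every point of $A$ and its sum is a continuous function on $A$. *)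

theory Defs
  imports "HOL-Analysis.Analysis"
begin

definition Omega1 :: "real set" where
  "Omega1 = {-1<..<1}"

definition eigval :: "nat \<Rightarrow> real" where
  "eigval k = (real k * pi / 2)\<^sup>2"

definition eigfun :: "nat \<Rightarrow> real \<Rightarrow> real" where
  "eigfun k x = sin (real k * pi / 2 * (x + 1))"

definition in_L2 :: "real set \<Rightarrow> (real \<Rightarrow> real) \<Rightarrow> bool" where
  "in_L2 A f \<longleftrightarrow> f \<in> borel_measurable (lebesgue_on A) \<and> integrable (lebesgue_on A) (\<lambda>x. (f x)\<^sup>2)"

definition L2_inner :: "real set \<Rightarrow> (real \<Rightarrow> real) \<Rightarrow> (real \<Rightarrow> real) \<Rightarrow> real" where
  "L2_inner A f g = (\<integral>x. f x * g x \<partial>lebesgue_on A)"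

definition dirac0 :: "(real \<Rightarrow> real) \<Rightarrow> real" where
  "dirac0 \<phi> = \<phi> 0"

text \<open>
  The solution need not be a function in \<open>L\<^sub>2\<close> (nor a pointwise convergent series), so it is
  represented as a formal series, i.e. by the sequence \<open>u\<close> of its terms. Its sine coefficient
  \<open>(u, e\<^sub>k)\<close> is obtained by pairing termwise, and \<open>(-\<Delta>)\<^sup>s\<close> acts on these coefficients.
  The eigenfunctions are indexed by \<open>k \<ge> 1\<close>.
\<close>

definition sine_coeff :: "(nat \<Rightarrow> real \<Rightarrow> real) \<Rightarrow> nat \<Rightarrow> real" where
  "sine_coeff u k = (\<Sum>m. L2_inner Omega1 (u m) (eigfun k))"

definition frac_laplacian_coeff :: "real \<Rightarrow> (nat \<Rightarrow> real \<Rightarrow> real) \<Rightarrow> nat \<Rightarrow> real" where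
  "frac_laplacian_coeff s u k = eigval k powr s * sine_coeff u k"

definition solves_frac_dirac :: "real \<Rightarrow> (nat \<Rightarrow> real \<Rightarrow> real) \<Rightarrow> bool" where
  "solves_frac_dirac s u \<longleftrightarrow>
     (\<forall>m. in_L2 Omega1 (u m)) \<and>
     (\<forall>k\<ge>1. summable (\<lambda>m. L2_inner Omega1 (u m) (eigfun k)) \<and>
             frac_laplacian_coeff s u k = dirac0 (eigfun k)) \<and>
     (\<lambda>m. u m (-1)) sums 0 \<and> (\<lambda>m. u m 1) sums 0"

definition series_in_L2 :: "real set \<Rightarrow> (nat \<Rightarrow> real \<Rightarrow> real) \<Rightarrow> bool" where
  "series_in_L2 A u \<longleftrightarrow>
     (\<forall>m. in_L2 A (u m)) \<and>
     (\<exists>f. in_L2 A f \<and>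
          (\<lambda>n. \<integral>x. ((\<Sum>m<n. u m x) - f x)\<^sup>2 \<partial>lebesgue_on A) \<longlonglongrightarrow> 0)"

definition series_in_C :: "real set \<Rightarrow> (nat \<Rightarrow> real \<Rightarrow> real) \<Rightarrow> bool" where
  "series_in_C A u \<longleftrightarrow>
     (\<forall>x\<in>A. summable (\<lambda>m. u m x)) \<and> continuous_on A (\<lambda>x. \<Sum>m. u m x)"

text \<open>The \<open>m\<close>-th term of the series \<open>w\<^sub>1\<^sub>,\<^sub>s\<close>, with the prefactor moved inside the sum.\<close>

definition w1 :: "real \<Rightarrow> nat \<Rightarrow> real \<Rightarrow> real" where
  "w1 s m x = (2 / pi) powr (2 * s) *
     ((-1) ^ m / (2 * real m + 1) powr (2 * s) * sin ((2 * real m + 1) * pi / 2 * (x + 1)))"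

end

theory Submission
  imports Defs "HOL-Real_Asymp.Real_Asymp"
begin

text \<open>
  Abel summation turns \<open>2 sin t \<Sum> a\<^sub>m cos ((2m + 1) t)\<close> with \<open>a\<close> decreasing to 0 into the series
  \<open>\<Sum> (a\<^sub>m - a\<^sub>m\<^sub>+\<^sub>1) sin (2 (m + 1) t)\<close>, which is dominated by a telescoping series. So
  \<open>w\<^sub>1\<^sub>,\<^sub>s\<close> converges to a continuous function wherever \<open>sin (\<pi> x / 2) \<noteq> 0\<close>, for every \<open>s > 0\<close>;
  at the origin, and uniformly, convergence amounts to that of \<open>\<Sum> (2m + 1) powr (-2s)\<close>. By
  orthonormality of the eigenfunctions, convergence in \<open>L\<^sub>2\<close> amounts to that of \<open>\<Sum> (2m + 1) powr (-4s)\<close>.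
\<close>

section \<open>Odd p-series and cosine series with monotone coefficients\<close>

lemma summable_odd_powr_iff:
  fixes p :: real
  shows "summable (\<lambda>m. 1 / (2 * real m + 1) powr p) \<longleftrightarrow> p > 1"
proof -
  let ?f = "\<lambda>m. 1 / (2 * real m + 1) powr p" and ?g = "\<lambda>m. real m powr (-p)"
  \<comment> \<open>Domination in both directions transfers convergence both ways; it is eventual,
    so the default value \<open>0 powr (-p) = 0\<close> of \<open>?g\<close> at \<open>m = 0\<close>
    is harmless.\<close>
  have "?f \<in> O(?g)" "?g \<in> O(?f)"
    by real_asymp+
  then have "summable ?f \<longleftrightarrow> summable ?g"
    using summable_comparison_test_bigo[of ?g ?f] summable_comparison_test_bigo[of ?f ?g] by auto
  then show ?thesis by (simp add: summable_real_powr_iff)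
qed

text \<open>Each product \<open>2 * sin t * cos ((2 * real m + 1) * t)\<close> is a difference of
  consecutive values of \<open>sin (2 * real m * t)\<close>. Summation by parts leaves only the
  upper boundary term, since the lower one contains \<open>sin 0\<close>.\<close>

lemma sum_cos_odd_by_parts:
  fixes a :: "nat \<Rightarrow> real"
  shows "2 * sin t * (\<Sum>m<n. a m * cos ((2 * real m + 1) * t)) =
    a n * sin (2 * real n * t) + (\<Sum>m<n. (a m - a (Suc m)) * sin (2 * (real m + 1) * t))"
proof (induction n)
  case (Suc n)
  have "sin (2 * (real n + 1) * t) = sin ((2 * real n + 1) * t + t)"
    "sin (2 * real n * t) = sin ((2 * real n + 1) * t - t)"
    by (simp_all add: algebra_simps)
  then have "2 * sin t * cos ((2 * real n + 1) * t) = sin (2 * (real n + 1) * t) - sin (2 * real n * t)"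
    by (simp add: sin_add sin_diff)
  then have "2 * sin t * (a n * cos ((2 * real n + 1) * t))
      = a n * (sin (2 * (real n + 1) * t) - sin (2 * real n * t))"
    by (metis mult.left_commute)
  with Suc show ?case
    by (simp add: algebra_simps)
qed simp

text \<open>Both claims come from one formula: away from the zeros of the sine, the sum equals a
  continuous function divided by \<open>2 * sin t\<close>. The coefficients themselves need not be
  summable.\<close>

lemma
  fixes a :: "nat \<Rightarrow> real" and T :: "real set"
  assumes dec: "decseq a" and lim: "a \<longlonglongrightarrow> 0" and nz: "\<And>t. t \<in> T \<Longrightarrow> sin t \<noteq> 0"
  shows cos_odd_series_summable: "t \<in> T \<Longrightarrow> summable (\<lambda>m. a m * cos ((2 * real m + 1) * t))"
    and cos_odd_series_continuous: "continuous_on T (\<lambda>t. \<Sum>m. a m * cos ((2 * real m + 1) * t))"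
proof -
  define d where "d m t = (a m - a (Suc m)) * sin (2 * (real m + 1) * t)" for m t
  have d_bound: "norm (d m t) \<le> a m - a (Suc m)" for m t
    using decseq_SucD[OF dec, of m]
    by (simp add: d_def abs_mult mult_left_le)
  have tele: "summable (\<lambda>m. a m - a (Suc m))"
    using telescope_sums'[OF lim] by (rule sums_summable)
  have d_sums: "(\<lambda>m. d m t) sums (\<Sum>m. d m t)" for t
    using summable_comparison_test'[OF tele, of 0 "\<lambda>m. d m t"] d_bound by (intro summable_sums) auto
  \<comment> \<open>The transformed series converges uniformly on the whole line; a singularity can
    enter only through the later division by \<open>2 * sin t\<close>.\<close>
  have "uniform_limit UNIV (\<lambda>n t. \<Sum>m<n. d m t) (\<lambda>t. \<Sum>m. d m t) sequentially"
    using d_bound tele by (intro Weierstrass_m_test[where M = "\<lambda>m. a m - a (Suc m)"]) auto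
  then have cont: "continuous_on UNIV (\<lambda>t. \<Sum>m. d m t)"
    by (rule uniform_limit_theorem[rotated])
      (auto intro!: always_eventually continuous_intros simp: d_def)
  have sums: "(\<lambda>m. a m * cos ((2 * real m + 1) * t)) sums ((\<Sum>m. d m t) / (2 * sin t))"
    if "t \<in> T" for t
  proof -
    have "(\<lambda>n. a n * sin (2 * real n * t)) \<longlonglongrightarrow> 0"
      by (rule Lim_null_comparison[OF _ lim])
        (use decseq_ge[OF dec lim] in \<open>auto simp: abs_mult mult_left_le\<close>)
    then have "(\<lambda>n. (a n * sin (2 * real n * t) + (\<Sum>m<n. d m t)) / (2 * sin t))
        \<longlonglongrightarrow> (0 + (\<Sum>m. d m t)) / (2 * sin t)"
      using d_sums[of t] nz[OF that] unfolding sums_def by (intro tendsto_intros) auto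
    also have "(\<lambda>n. (a n * sin (2 * real n * t) + (\<Sum>m<n. d m t)) / (2 * sin t))
        = (\<lambda>n. \<Sum>m<n. a m * cos ((2 * real m + 1) * t))"
      unfolding d_def sum_cos_odd_by_parts[symmetric] using nz[OF that] by simp
    finally show ?thesis by (simp add: sums_def)
  qed
  show "t \<in> T \<Longrightarrow> summable (\<lambda>m. a m * cos ((2 * real m + 1) * t))"
    using sums by (rule sums_summable)
  have "continuous_on T (\<lambda>t. (\<Sum>m. d m t) / (2 * sin t))"
    using nz by (intro continuous_intros continuous_on_subset[OF cont]) auto
  then show "continuous_on T (\<lambda>t. \<Sum>m. a m * cos ((2 * real m + 1) * t))"
    by (rule continuous_on_eq) (use sums in \<open>simp add: sums_iff\<close>)
qed

section \<open>Mean-square convergence of orthonormal series\<close>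

lemma in_L2_diff:
  assumes "in_L2 A f" "in_L2 A g"
  shows "in_L2 A (\<lambda>x. f x - g x)"
proof -
  have [measurable]: "f \<in> borel_measurable (lebesgue_on A)" "g \<in> borel_measurable (lebesgue_on A)"
    using assms by (auto simp: in_L2_def)
  have "integrable (lebesgue_on A) (\<lambda>x. (f x - g x)\<^sup>2)"
  proof (rule Bochner_Integration.integrable_bound)
    show "integrable (lebesgue_on A) (\<lambda>x. 2 * (f x)\<^sup>2 + 2 * (g x)\<^sup>2)"
      using assms by (auto simp: in_L2_def)
    \<comment> \<open>The gap between the two sides is exactly the square of
      \<open>f x + g x\<close>.\<close>
    have "(f x - g x)\<^sup>2 \<le> 2 * (f x)\<^sup>2 + 2 * (g x)\<^sup>2" for x
      using zero_le_power2[of "f x + g x"] by (simp add: power2_eq_square algebra_simps)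
    then show "AE x in lebesgue_on A. norm ((f x - g x)\<^sup>2) \<le> norm (2 * (f x)\<^sup>2 + 2 * (g x)\<^sup>2)"
      by simp
  qed measurable
  then show ?thesis by (simp add: in_L2_def)
qed

text \<open>Separates the Hilbert space argument from trigonometry; it is instantiated below with
  the eigenfunctions of odd index.\<close>

locale L2_orthonormal =
  fixes A :: "real set" and e :: "nat \<Rightarrow> real \<Rightarrow> real"
  assumes e_measurable [measurable]: "\<And>m. e m \<in> borel_measurable (lebesgue_on A)"
    and e_integrable: "\<And>j k. integrable (lebesgue_on A) (\<lambda>x. e j x * e k x)"
    and e_inner: "\<And>j k. L2_inner A (e j) (e k) = (if j = k then 1 else 0)"
begin

text \<open>Pythagoras: after expanding the square, orthogonality removes the cross terms. An
  arbitrary finite \<open>J\<close> covers initial segments, single terms and the blocks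
  \<open>{n..<N + n}\<close>.\<close>

lemma
  assumes "finite J"
  shows in_L2_sum: "in_L2 A (\<lambda>x. \<Sum>m\<in>J. c m * e m x)"
    and integral_sum_square: "(\<integral>x. (\<Sum>m\<in>J. c m * e m x)\<^sup>2 \<partial>lebesgue_on A) = (\<Sum>m\<in>J. (c m)\<^sup>2)"
proof -
  have expand: "(\<Sum>m\<in>J. c m * e m x)\<^sup>2 = (\<Sum>i\<in>J. \<Sum>j\<in>J. (c i * c j) * (e i x * e j x))" for x
    by (simp add: power2_eq_square sum_product mult_ac)
  show "in_L2 A (\<lambda>x. \<Sum>m\<in>J. c m * e m x)"
    unfolding in_L2_def expand by (auto intro!: integrable_sum integrable_mult_right e_integrable)
  have "(\<integral>x. (\<Sum>m\<in>J. c m * e m x)\<^sup>2 \<partial>lebesgue_on A)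
      = (\<Sum>i\<in>J. \<Sum>j\<in>J. (c i * c j) * L2_inner A (e i) (e j))"
    unfolding expand L2_inner_def
    by (simp add: Bochner_Integration.integral_sum integrable_sum e_integrable)
  also have "\<dots> = (\<Sum>m\<in>J. (c m)\<^sup>2)"
    using assms by (simp add: e_inner power2_eq_square if_distrib cong: if_cong)
  finally show "(\<integral>x. (\<Sum>m\<in>J. c m * e m x)\<^sup>2 \<partial>lebesgue_on A) = (\<Sum>m\<in>J. (c m)\<^sup>2)" .
qed

text \<open>The partial sums of the squares are squared norms of partial sums of the series. These
  stay bounded, because the errors converge and the limit has finite norm.\<close>

lemma summable_square_if_series_in_L2:
  assumes "series_in_L2 A (\<lambda>m x. c m * e m x)"
  shows "summable (\<lambda>m. (c m)\<^sup>2)"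
proof -
  obtain f where f: "in_L2 A f"
    and lim: "(\<lambda>n. \<integral>x. ((\<Sum>m<n. c m * e m x) - f x)\<^sup>2 \<partial>lebesgue_on A) \<longlonglongrightarrow> 0"
    using assms by (auto simp: series_in_L2_def)
  define r where "r n = (\<integral>x. ((\<Sum>m<n. c m * e m x) - f x)\<^sup>2 \<partial>lebesgue_on A)" for n
  have "Bseq r"
    using lim unfolding r_def by (intro convergent_imp_Bseq convergentI)
  then obtain K where K: "\<And>n. norm (r n) \<le> K"
    by (auto simp: Bseq_def)
  have "(\<Sum>m<n. (c m)\<^sup>2) \<le> 2 * K + 2 * (\<integral>x. (f x)\<^sup>2 \<partial>lebesgue_on A)" for n
  proof -
    let ?S = "\<lambda>x. \<Sum>m<n. c m * e m x"
    have S: "in_L2 A ?S" and D: "in_L2 A (\<lambda>x. ?S x - f x)"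
      by (auto intro: in_L2_sum in_L2_diff f)
    have "(\<Sum>m<n. (c m)\<^sup>2) = (\<integral>x. (?S x)\<^sup>2 \<partial>lebesgue_on A)"
      by (simp add: integral_sum_square)
    also have "\<dots> \<le> (\<integral>x. 2 * (?S x - f x)\<^sup>2 + 2 * (f x)\<^sup>2 \<partial>lebesgue_on A)"
    proof (rule integral_mono)
      fix x
      \<comment> \<open>Here the gap is the square of \<open>?S x - 2 * f x\<close>.\<close>
      show "(?S x)\<^sup>2 \<le> 2 * (?S x - f x)\<^sup>2 + 2 * (f x)\<^sup>2"
        using zero_le_power2[of "?S x - 2 * f x"] by (simp add: power2_eq_square algebra_simps)
    qed (use S D f in \<open>auto simp: in_L2_def\<close>)
    also have "\<dots> = 2 * r n + 2 * (\<integral>x. (f x)\<^sup>2 \<partial>lebesgue_on A)"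
      using D f by (simp add: in_L2_def r_def)
    finally show ?thesis
      using K[of n] by simp
  qed
  then show ?thesis
    by (intro summableI_nonneg_bounded) auto
qed

text \<open>
  Almost everywhere convergence supplies the limit function, so Fatou's lemma replaces the
  completeness of \<open>L\<^sub>2\<close>.
\<close>

lemma series_in_L2_if_summable_square:
  assumes summ: "summable (\<lambda>m. (c m)\<^sup>2)"
    and ae: "AE x in lebesgue_on A. summable (\<lambda>m. c m * e m x)"
  shows "series_in_L2 A (\<lambda>m x. c m * e m x)"
proof -
  define S where "S n x = (\<Sum>m<n. c m * e m x)" for n x
  define f where "f x = (\<Sum>m. c m * e m x)" for x
  define tail where "tail n = (\<Sum>m. (c (m + n))\<^sup>2)" for n
  have [measurable]: "S n \<in> borel_measurable (lebesgue_on A)" for n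
    unfolding S_def by measurable
  have [measurable]: "f \<in> borel_measurable (lebesgue_on A)"
    unfolding f_def by measurable
  have tail_nonneg: "0 \<le> tail n" for n
    unfolding tail_def using summable_ignore_initial_segment[OF summ] by (intro suminf_nonneg) auto
  \<comment> \<open>By Pythagoras the block from \<open>n\<close> to \<open>N + n\<close> has
    squared norm at most the tail from \<open>n\<close>, uniformly in \<open>N\<close>.\<close>
  have increment: "(\<integral>\<^sup>+x. ennreal ((S (N + n) x - S n x)\<^sup>2) \<partial>lebesgue_on A) \<le> ennreal (tail n)" for n N
  proof -
    have S_diff: "S (N + n) x - S n x = (\<Sum>m\<in>{n..<N + n}. c m * e m x)" for x
      unfolding S_def by (simp add: lessThan_atLeast0 sum_diff_nat_ivl)
    have "(\<integral>\<^sup>+x. ennreal ((S (N + n) x - S n x)\<^sup>2) \<partial>lebesgue_on A) = ennreal (\<Sum>m\<in>{n..<N + n}. (c m)\<^sup>2)"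
      unfolding S_diff using in_L2_sum[of "{n..<N + n}" c]
      by (subst nn_integral_eq_integral) (auto simp: integral_sum_square in_L2_def)
    also have "(\<Sum>m\<in>{n..<N + n}. (c m)\<^sup>2) = (\<Sum>m<N. (c (m + n))\<^sup>2)"
      using sum.shift_bounds_nat_ivl[of "\<lambda>m. (c m)\<^sup>2" 0 n N] by (simp add: lessThan_atLeast0)
    also have "\<dots> \<le> tail n"
      unfolding tail_def using summable_ignore_initial_segment[OF summ] by (intro sum_le_suminf) auto
    finally show ?thesis by (simp add: ennreal_leI)
  qed
  \<comment> \<open>Now \<open>n\<close> is fixed and \<open>N\<close> tends to infinity: the
    increments tend almost everywhere to the error at \<open>n\<close>, which inherits their uniform
    bound.\<close>
  have fatou: "(\<integral>\<^sup>+x. ennreal ((S n x - f x)\<^sup>2) \<partial>lebesgue_on A) \<le> ennreal (tail n)" for n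
  proof -
    have "(\<integral>\<^sup>+x. ennreal ((S n x - f x)\<^sup>2) \<partial>lebesgue_on A)
        = (\<integral>\<^sup>+x. liminf (\<lambda>N. ennreal ((S (N + n) x - S n x)\<^sup>2)) \<partial>lebesgue_on A)"
    proof (rule nn_integral_cong_AE)
      show "AE x in lebesgue_on A.
          ennreal ((S n x - f x)\<^sup>2) = liminf (\<lambda>N. ennreal ((S (N + n) x - S n x)\<^sup>2))"
        using ae
      proof eventually_elim
        case (elim x)
        have "(\<lambda>N. S N x) \<longlonglongrightarrow> f x"
          using summable_LIMSEQ[OF elim] by (simp add: S_def f_def)
        then have "(\<lambda>N. S (N + n) x) \<longlonglongrightarrow> f x"
          by (rule LIMSEQ_ignore_initial_segment)
        then have "(\<lambda>N. ennreal ((S (N + n) x - S n x)\<^sup>2)) \<longlonglongrightarrow> ennreal ((f x - S n x)\<^sup>2)"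
          by (intro tendsto_intros)
        then show ?case
          by (simp add: lim_imp_Liminf power2_commute[of "S n x" "f x"] del: tendsto_ennreal_iff)
      qed
    qed
    also have "\<dots> \<le> liminf (\<lambda>N. \<integral>\<^sup>+x. ennreal ((S (N + n) x - S n x)\<^sup>2) \<partial>lebesgue_on A)"
      by (rule nn_integral_liminf) measurable
    also have "\<dots> \<le> liminf (\<lambda>N. ennreal (tail n))"
      using increment by (intro Liminf_mono always_eventually) auto
    finally show ?thesis by (simp add: Liminf_const)
  qed
  have err_integrable: "integrable (lebesgue_on A) (\<lambda>x. (S n x - f x)\<^sup>2)" for n
    using fatou[of n] by (intro integrableI_nonneg) (auto simp: le_less_trans)
  \<comment> \<open>\<open>S 0\<close> is the empty sum, so the error at index 0 is the square of
    \<open>f\<close> itself.\<close>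
  have "in_L2 A f"
    using err_integrable[of 0] by (simp add: in_L2_def S_def)
  moreover have "(\<lambda>n. \<integral>x. (S n x - f x)\<^sup>2 \<partial>lebesgue_on A) \<longlonglongrightarrow> 0"
  proof (rule tendsto_sandwich[OF _ _ tendsto_const])
    show "\<forall>\<^sub>F n in sequentially. (\<integral>x. (S n x - f x)\<^sup>2 \<partial>lebesgue_on A) \<le> tail n"
      using fatou tail_nonneg
      by (intro always_eventually allI) (simp add: nn_integral_eq_integral[OF err_integrable])
    show "tail \<longlonglongrightarrow> 0"
      unfolding tail_def using suminf_exist_split2[OF summ] by simp
  qed simp
  moreover have "in_L2 A (\<lambda>x. c m * e m x)" for m
    using in_L2_sum[of "{m}" c] by simp
  ultimately show ?thesis
    unfolding series_in_L2_def S_def by blast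
qed

end

section \<open>Orthonormality of the Dirichlet eigenfunctions\<close>

lemma integrable_Omega1:
  fixes f :: "real \<Rightarrow> real"
  assumes "continuous_on {-1..1} f"
  shows "integrable (lebesgue_on Omega1) f"
proof -
  have "set_integrable lebesgue {-1..1} f"
    using continuous_imp_integrable_real[OF assms] by (simp add: integrable_restrict_space set_integrable_def)
  then have "set_integrable lebesgue Omega1 f"
    by (rule set_integrable_subset) (auto simp: Omega1_def)
  then show ?thesis
    by (simp add: integrable_restrict_space set_integrable_def Omega1_def)
qed

text \<open>For nonzero \<open>n\<close> the sine antiderivative vanishes at both ends, its argument
  being 0 and \<open>n\<close> times pi there. The index is an integer because differences of
  eigenfunction indices may be negative.\<close>

lemma integral_Omega1_cos:
  "(\<integral>x. cos (real_of_int n * pi / 2 * (x + 1)) \<partial>lebesgue_on Omega1) = (if n = 0 then 2 else 0)"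
proof -
  let ?f = "\<lambda>x. cos (real_of_int n * pi / 2 * (x + 1))"
  have "(\<integral>x. ?f x \<partial>lebesgue_on Omega1) = integral {-1<..<1} ?f"
    unfolding Omega1_def[symmetric]
    by (intro lebesgue_integral_eq_integral integrable_Omega1 continuous_intros)
      (auto simp: Omega1_def)
  also have "\<dots> = integral {-1..1} ?f"
    by (rule integral_open_interval_real[symmetric])
  also have "\<dots> = (if n = 0 then 2 else 0)"
  proof (cases "n = 0")
    case False
    let ?F = "\<lambda>x. sin (real_of_int n * pi / 2 * (x + 1)) / (real_of_int n * pi / 2)"
    have "(?f has_integral ?F 1 - ?F (-1)) {-1..1}"
    proof (rule fundamental_theorem_of_calculus)
      fix x :: real
      show "(?F has_vector_derivative ?f x) (at x within {-1..1})"
        unfolding has_real_derivative_iff_has_vector_derivative[symmetric]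
        using False by (auto intro!: derivative_eq_intros simp: field_simps)
    qed simp
    moreover have "sin (real_of_int n * pi) = 0"
      by (simp add: sin_zero_iff_int2)
    ultimately show ?thesis
      using False by (simp add: integral_unique)
  qed simp
  finally show ?thesis .
qed

lemma continuous_on_eigfun [continuous_intros]: "continuous_on T (eigfun k)"
  unfolding eigfun_def by (intro continuous_intros)

text \<open>The product-to-sum formula gives cosines with indices \<open>j - k\<close> and
  \<open>j + k\<close>. Since \<open>j \<ge> 1\<close>, the second index is never 0; the first
  contributes half the interval length 2 exactly when \<open>j = k\<close>.\<close>

lemma L2_inner_eigfun:
  assumes "j \<ge> 1"
  shows "L2_inner Omega1 (eigfun j) (eigfun k) = (if j = k then 1 else 0)"
proof -
  let ?c = "\<lambda>n x. cos (real_of_int n * pi / 2 * (x + 1))"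
  have prod: "eigfun j x * eigfun k x = (?c (int j - int k) x - ?c (int j + int k) x) / 2" for x
    unfolding eigfun_def sin_times_sin by (simp add: algebra_simps add_divide_distrib diff_divide_distrib)
  have "L2_inner Omega1 (eigfun j) (eigfun k)
      = (\<integral>x. (?c (int j - int k) x - ?c (int j + int k) x) / 2 \<partial>lebesgue_on Omega1)"
    by (simp only: L2_inner_def prod)
  also have "\<dots> = ((\<integral>x. ?c (int j - int k) x \<partial>lebesgue_on Omega1)
      - (\<integral>x. ?c (int j + int k) x \<partial>lebesgue_on Omega1)) / 2"
    by (subst integral_divide_zero, subst Bochner_Integration.integral_diff)
      (auto intro!: integrable_Omega1 continuous_intros)
  also have "\<dots> = (if j = k then 1 else 0)"
    unfolding integral_Omega1_cos using assms by auto
  finally show ?thesis .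
qed

interpretation odd_eigfun: L2_orthonormal Omega1 "\<lambda>m. eigfun (2 * m + 1)"
proof
  show "eigfun (2 * m + 1) \<in> borel_measurable (lebesgue_on Omega1)" for m
    by (intro borel_measurable_integrable integrable_Omega1 continuous_intros)
  show "integrable (lebesgue_on Omega1) (\<lambda>x. eigfun (2 * j + 1) x * eigfun (2 * k + 1) x)" for j k
    by (intro integrable_Omega1 continuous_intros)
  show "L2_inner Omega1 (eigfun (2 * j + 1)) (eigfun (2 * k + 1)) = (if j = k then 1 else 0)" for j k
    by (simp add: L2_inner_eigfun)
qed

section \<open>The series \<open>w1\<close>: coefficients, equation, continuity and square
  integrability\<close>

definition w1_coeff :: "real \<Rightarrow> nat \<Rightarrow> real" where
  "w1_coeff s m = (2 / pi) powr (2 * s) * ((-1) ^ m / (2 * real m + 1) powr (2 * s))"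

lemma w1_eigfun: "w1 s m x = w1_coeff s m * eigfun (2 * m + 1) x"
  by (simp add: w1_def w1_coeff_def eigfun_def add.commute)

lemma sin_half_odd_pi: "sin ((2 * real m + 1) * pi / 2) = (-1) ^ m"
proof -
  have "sin ((2 * real m + 1) * pi / 2) = sin (real m * pi + pi / 2)"
    by (simp add: field_simps)
  then show ?thesis by (simp add: sin_add)
qed

lemma cos_half_odd_pi: "cos ((2 * real m + 1) * pi / 2) = 0"
proof -
  have "cos ((2 * real m + 1) * pi / 2) = cos (real m * pi + pi / 2)"
    by (simp add: field_simps)
  then show ?thesis by (simp add: cos_add)
qed

text \<open>Shifting the argument by an odd multiple of pi/2 turns the sine into a cosine with sign
  \<open>(-1) ^ m\<close>, which cancels the sign in the term.\<close>

lemma w1_cos: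
  "w1 s m x = (2 / pi) powr (2 * s) *
     (1 / (2 * real m + 1) powr (2 * s) * cos ((2 * real m + 1) * pi * x / 2))"
proof -
  have "(2 * real m + 1) * pi / 2 * (x + 1) = (2 * real m + 1) * pi * x / 2 + (2 * real m + 1) * pi / 2"
    by (simp add: field_simps)
  then have "sin ((2 * real m + 1) * pi / 2 * (x + 1)) = (-1) ^ m * cos ((2 * real m + 1) * pi * x / 2)"
    by (simp only: sin_add sin_half_odd_pi cos_half_odd_pi) simp
  then show ?thesis
    unfolding w1_def by (simp flip: power_mult_distrib add: mult.assoc[symmetric])
qed

text \<open>Pairing with \<open>eigfun k\<close> keeps at most one term of the series. For even
  \<open>k\<close> none survives, matching the zero of \<open>eigfun k\<close> at the origin; for
  odd \<open>k\<close> the single coefficient is compared directly.\<close>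

lemma w1_solves: "solves_frac_dirac s (w1 s)"
proof -
  have inner: "L2_inner Omega1 (w1 s m) (eigfun k) = (if 2 * m + 1 = k then w1_coeff s m else 0)" for m k
    using L2_inner_eigfun[of "2 * m + 1" k] by (auto simp: L2_inner_def w1_eigfun mult.assoc)
  have coeff: "(\<lambda>m. L2_inner Omega1 (w1 s m) (eigfun k)) sums (dirac0 (eigfun k) / eigval k powr s)"
    if "k \<ge> 1" for k
  proof (cases "even k")
    case True
    then obtain p where p: "k = 2 * p" by blast
    have "dirac0 (eigfun k) = 0"
      by (simp add: dirac0_def eigfun_def p)
    moreover have "L2_inner Omega1 (w1 s m) (eigfun k) = 0" for m
      unfolding inner p using double_not_eq_Suc_double[of p m] by simp
    ultimately show ?thesis by simp
  next
    case False
    then obtain p where p: "k = 2 * p + 1" by (elim oddE)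
    have "eigval k powr s = ((2 * real p + 1) * pi / 2) powr (2 * s)"
      by (simp add: eigval_def p powr_powr add.commute flip: powr_numeral)
    also have "\<dots> = (2 * real p + 1) powr (2 * s) / (2 / pi) powr (2 * s)"
      by (simp add: powr_mult powr_divide)
    finally have "dirac0 (eigfun k) / eigval k powr s = w1_coeff s p"
      using sin_half_odd_pi[of p] by (simp add: dirac0_def eigfun_def w1_coeff_def p add.commute)
    moreover have "(\<lambda>m. L2_inner Omega1 (w1 s m) (eigfun k)) sums w1_coeff s p"
      using sums_single[of p "w1_coeff s"] by (simp add: inner p eq_commute)
    ultimately show ?thesis by simp
  qed
  have "w1 s m 1 = 0" for m
    using cos_half_odd_pi[of m] by (simp add: w1_cos)
  moreover have "w1 s m (-1) = 0" for m
    by (simp add: w1_def)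
  moreover have "in_L2 Omega1 (w1 s m)" for m
    using odd_eigfun.in_L2_sum[of "{m}" "w1_coeff s"] by (simp add: w1_eigfun[abs_def])
  moreover have "eigval k > 0" if "k \<ge> 1" for k
    using that by (simp add: eigval_def)
  ultimately show ?thesis
    using coeff sums_summable
    by (force simp: solves_frac_dirac_def frac_laplacian_coeff_def sine_coeff_def sums_iff)
qed

lemma w1_series_in_C_punctured:
  assumes "s > 0"
  shows "series_in_C (closure Omega1 - {0}) (w1 s)"
proof -
  define a where "a m = (2 / pi) powr (2 * s) / (2 * real m + 1) powr (2 * s)" for m
  have w1: "w1 s m x = a m * cos ((2 * real m + 1) * (pi * x / 2))" for m x
    by (simp add: w1_cos a_def mult.assoc)
  have dec: "decseq a"
    unfolding decseq_def a_def using assms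
    by (auto intro!: divide_left_mono powr_mono2 mult_pos_pos)
  have lim: "a \<longlonglongrightarrow> 0"
    unfolding a_def using assms by real_asymp
  let ?T = "(\<lambda>x. pi * x / 2) ` (closure Omega1 - {0})"
  \<comment> \<open>On the punctured closed interval \<open>t = pi * x / 2\<close> satisfies 0 < |t|
    < pi, where the sine has no zero.\<close>
  have nz: "sin t \<noteq> 0" if t: "t \<in> ?T" for t
  proof -
    obtain x where "x \<in> closure Omega1 - {0}" and x: "t = pi * x / 2"
      using t by blast
    then have "\<bar>x\<bar> \<le> 1" "x \<noteq> 0"
      by (auto simp: Omega1_def)
    then have "pi * \<bar>x\<bar> \<le> pi * 1" "t \<noteq> 0"
      by (intro mult_left_mono, auto simp: x)
    then have "\<bar>t\<bar> < pi" "t \<noteq> 0"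
      unfolding x abs_divide abs_mult using pi_gt_zero by auto
    then show ?thesis
      using sin_eq_0_pi[of t] by (auto simp: abs_less_iff)
  qed
  have "continuous_on (closure Omega1 - {0})
      (\<lambda>x. (\<lambda>t. \<Sum>m. a m * cos ((2 * real m + 1) * t)) (pi * x / 2))"
    by (rule continuous_on_compose2[OF cos_odd_series_continuous[OF dec lim nz]])
      (auto intro!: continuous_intros)
  moreover have "summable (\<lambda>m. a m * cos ((2 * real m + 1) * (pi * x / 2)))"
    if "x \<in> closure Omega1 - {0}" for x
    by (rule cos_odd_series_summable[OF dec lim nz imageI[OF that]])
  ultimately show ?thesis
    unfolding series_in_C_def w1 by blast
qed

text \<open>Weierstrass test: the terms at the origin majorize the terms everywhere and are
  summable, as \<open>2 * s > 1\<close>.\<close>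

lemma w1_series_in_C:
  assumes "s > 1/2"
  shows "series_in_C X (w1 s)"
proof -
  define a where "a m = (2 / pi) powr (2 * s) * (1 / (2 * real m + 1) powr (2 * s))" for m
  have summ: "summable a"
    unfolding a_def using assms by (intro summable_mult) (simp add: summable_odd_powr_iff)
  have bound: "norm (w1 s m x) \<le> a m" for m x
    by (simp add: w1_cos a_def abs_mult divide_le_cancel mult_left_le)
  have "uniform_limit X (\<lambda>n x. \<Sum>m<n. w1 s m x) (\<lambda>x. \<Sum>m. w1 s m x) sequentially"
    using bound summ by (intro Weierstrass_m_test) auto
  then have "continuous_on X (\<lambda>x. \<Sum>m. w1 s m x)"
    by (rule uniform_limit_theorem[rotated])
      (auto intro!: always_eventually continuous_intros simp: w1_def)
  moreover have "summable (\<lambda>m. w1 s m x)" for x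
    using summable_comparison_test'[OF summ, of 0 "\<lambda>m. w1 s m x"] bound by auto
  ultimately show ?thesis by (simp add: series_in_C_def)
qed

text \<open>Squaring the coefficients doubles the exponent, so the threshold is
  \<open>4 * s > 1\<close>. The almost everywhere convergence required for one direction comes from
  the punctured interval, as the origin is a null set.\<close>

lemma w1_series_in_L2_iff:
  assumes "s > 0"
  shows "series_in_L2 Omega1 (w1 s) \<longleftrightarrow> s > 1/4"
proof -
  have "(w1_coeff s m)\<^sup>2 = ((2 / pi) powr (2 * s))\<^sup>2 * (1 / (2 * real m + 1) powr (4 * s))" for m
    by (simp add: w1_coeff_def power_mult_distrib power_divide flip: powr_numeral)
      (simp add: powr_powr mult_ac flip: power_mult)
  then have coeff: "summable (\<lambda>m. (w1_coeff s m)\<^sup>2) \<longleftrightarrow> s > 1/4"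
    by (auto simp only: summable_cmult_iff summable_odd_powr_iff) auto
  have w1: "w1 s = (\<lambda>m x. w1_coeff s m * eigfun (2 * m + 1) x)"
    by (simp add: fun_eq_iff w1_eigfun)
  have "AE x in lebesgue. x \<noteq> (0::real)"
    by (rule AE_not_in[of "{0}", simplified]) auto
  then have nonzero: "AE x in lebesgue_on Omega1. x \<noteq> 0"
    by (subst AE_restrict_space_iff) (auto simp: Omega1_def)
  have summ: "summable (\<lambda>m. w1 s m x)" if "x \<in> Omega1" "x \<noteq> 0" for x
    using w1_series_in_C_punctured[OF assms] that closure_subset[of Omega1]
    by (auto simp: series_in_C_def)
  have "AE x in lebesgue_on Omega1. summable (\<lambda>m. w1 s m x)"
    using nonzero by (rule lebesgue_on_mono) (rule summ)
  then show ?thesis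
    unfolding coeff[symmetric] w1
    using odd_eigfun.summable_square_if_series_in_L2 odd_eigfun.series_in_L2_if_summable_square
    by blast
qed

text \<open>Working in \<open>ereal\<close> gives the nonnegative series at the origin a genuine sum
  even when it diverges, so finiteness becomes a meaningful condition.\<close>

lemma w1_at_0_sums:
  "(\<lambda>m. ereal (w1 s m 0)) sums
     (ereal ((2 / pi) powr (2 * s)) * (\<Sum>m. ereal (1 / (2 * real m + 1) powr (2 * s))))"
proof -
  have "(\<lambda>m. ereal (w1 s m 0)) sums (\<Sum>m. ereal (w1 s m 0))"
    by (intro summable_sums summable_ereal_pos) (simp add: w1_cos)
  also have "(\<Sum>m. ereal (w1 s m 0))
      = (\<Sum>m. ereal ((2 / pi) powr (2 * s)) * ereal (1 / (2 * real m + 1) powr (2 * s)))"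
    by (simp add: w1_cos)
  also have "\<dots> = ereal ((2 / pi) powr (2 * s)) * (\<Sum>m. ereal (1 / (2 * real m + 1) powr (2 * s)))"
    by (intro suminf_cmult_ereal) auto
  finally show ?thesis .
qed

lemma odd_powr_suminf_finite_iff:
  "(\<Sum>m. ereal (1 / (2 * real m + 1) powr p)) < \<infinity> \<longleftrightarrow> p > 1"
proof -
  have "(\<Sum>m. ereal (1 / (2 * real m + 1) powr p)) \<noteq> \<infinity>
      \<longleftrightarrow> summable (\<lambda>m. 1 / (2 * real m + 1) powr p)"
    using summable_ereal[of "\<lambda>m. 1 / (2 * real m + 1) powr p"]
      suminf_ereal_finite[of "\<lambda>m. 1 / (2 * real m + 1) powr p"] by auto
  then show ?thesis
    by (simp add: summable_odd_powr_iff)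
qed

theorem theorem3p2:
  fixes s :: real
  assumes "s \<in> {0<..<1}"
  shows
    "(\<forall>m x. w1 s m x =
        (2 / pi) powr (2 * s) *
          (1 / (2 * real m + 1) powr (2 * s) * cos ((2 * real m + 1) * pi * x / 2))) \<and>
     solves_frac_dirac s (w1 s) \<and>
     (series_in_L2 Omega1 (w1 s) \<longleftrightarrow> s \<in> {1/4<..<1}) \<and>
     ((\<lambda>m. ereal (w1 s m 0)) sums
        (ereal ((2 / pi) powr (2 * s)) * (\<Sum>m. ereal (1 / (2 * real m + 1) powr (2 * s)))) \<and>
      (ereal ((2 / pi) powr (2 * s)) * (\<Sum>m. ereal (1 / (2 * real m + 1) powr (2 * s))) < \<infinity>
        \<longleftrightarrow> s > 1/2)) \<and>
     (s \<noteq> 1/2 \<longrightarrow> series_in_C (closure Omega1 - {0}) (w1 s)) \<and>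
     (s \<in> {1/2<..<1} \<longrightarrow> series_in_C (closure Omega1) (w1 s))"
proof -
  \<comment> \<open>The prefactor is positive and finite, so multiplying by it preserves both finite
    and infinite values.\<close>
  have "ereal ((2 / pi) powr (2 * s)) * (\<Sum>m. ereal (1 / (2 * real m + 1) powr (2 * s))) < \<infinity>
      \<longleftrightarrow> (\<Sum>m. ereal (1 / (2 * real m + 1) powr (2 * s))) < \<infinity>"
    by (cases "\<Sum>m. ereal (1 / (2 * real m + 1) powr (2 * s))") auto
  then have "ereal ((2 / pi) powr (2 * s)) * (\<Sum>m. ereal (1 / (2 * real m + 1) powr (2 * s))) < \<infinity>
      \<longleftrightarrow> s > 1/2"
    unfolding odd_powr_suminf_finite_iff by auto
  with assms show ?thesis
    using w1_cos w1_solves w1_series_in_L2_iff w1_at_0_sums w1_series_in_C_punctured w1_series_in_C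
    by auto
qed

end
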